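(* Let $d\ge1$ and let $\Lambda \subset \mathbb R^{2d}$ be a lattice. Then each of the following conditions is equivalent to $\Lambda$ being symplectically related to a separable lattice. (c) There exist a basis $(\lambda_1, \ldots, \lambda_{2d})$ for $\Lambda$ (as a $\mathbb Z$-module) and a transversal pair $(\ell, \ell')$ of $J$-Lagrangian planes such that $\{ \lambda_1, \ldots, \lambda_{2d} \} \subset \ell \cup \ell'$. (d) For some (and if so, for every) $\theta \in \Theta_\Lambda$, there exist a basis $(b_1, \ldots, b_{2d})$ for $\mathbb Z^{2d}$ (as a $\mathbb Z$-module) and a transversal pair $(\ell_\theta, \ell_\theta')$ of $\theta$-Lagrangian planes such that $\{ b_1, \ldots, b_{2d} \} \subset \ell_\theta \cup \ell_\theta'$.
   Context: $J = \begin{pmatrix} 0 & I \\ -I & 0\end{pmatrix}$ is the standard $2d\times 2d$ symplectic matrix; $\mathrm{Sp}(2d,\mathbb R)=\{S : S^TJS=J\}$. A lattice in $\mathbb R^{2d}$ is a set $A\mathbb Z^{2d}$ with $A\in\mathrm{GL}(2d,\mathbb R)$; such an $A$ is a lattice matrix for it. A lattice is separable if it is of the form $\begin{pmatrix} A_1 & 0\\ 0& A_2\end{pmatrix}\mathbb Z^{2d}$ with $A_1,A_2\in\mathrm{GL}(d,\mathbb R)$. Two lattices $\Lambda,\Lambda'$ in $\mathbb R^{2d}$ are symplectically related if $\Lambda'=S\Lambda$ for some $S\in\mathrm{Sp}(2d,\mathbb R)$. For a lattice $\Lambda=A\mathbb Z^{2d}$, $\Theta_\Lambda=\{(AM)^TJ(AM)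 : M\in\mathrm{GL}(2d,\mathbb Z)\}$, where $\mathrm{GL}(2d,\mathbb Z)$ is the group of integer matrices with integer inverse; this is the set of all matrices $B^TJB$ with $B$ a lattice matrix for $\Lambda$. For an antisymmetric invertible matrix $\theta\in\mathrm{GL}(2d,\mathbb R)$, let $\Omega(z,w)=w^T\theta z$ be the symplectic form on $\mathbb R^{2d}$ represented by $\theta$. A $\theta$-Lagrangian plane is a $d$-dimensional subspace $\ell\subset\mathbb R^{2d}$ such that $\Omega$ vanishes identically on $\ell\times\ell$. A pair $(\ell,\ell')$ of $\theta$-Lagrangian planes is transversal if $\ell+\ell'=\mathbb R^{2d}$. *)

theory Defs
  imports "HOL-Analysis.Analysis"
begin

text \<open>
  The index type of \<open>\<real>\<^sup>2\<^sup>d\<close> is \<^typ>\<open>'d + 'd\<close> with \<^term>\<open>CARD('d) = d\<close>: the coordinates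
  \<^term>\<open>Inl i\<close> come first, the coordinates \<^term>\<open>Inr i\<close> second.
\<close>

definition block_mat ::
    "real^'d^'d \<Rightarrow> real^'d^'d \<Rightarrow> real^'d^'d \<Rightarrow> real^'d^'d \<Rightarrow> real^('d + 'd)^('d + 'd)" where
  "block_mat P Q R S = (\<chi> i j. case i of
       Inl k \<Rightarrow> (case j of Inl l \<Rightarrow> P $ k $ l | Inr l \<Rightarrow> Q $ k $ l)
     | Inr k \<Rightarrow> (case j of Inl l \<Rightarrow> R $ k $ l | Inr l \<Rightarrow> S $ k $ l))"

definition J_mat :: "real^('d::finite + 'd)^('d + 'd)" where
  "J_mat = block_mat 0 (mat 1) (- mat 1) 0"

definition Sp :: "(real^('d::finite + 'd)^('d + 'd)) set" where
  "Sp = {S. transpose S ** J_mat ** S = J_mat}"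


subsection \<open>Lattices\<close>

definition int_vecs :: "(real^'n) set" where
  "int_vecs = {x. \<forall>i. x $ i \<in> \<int>}"

definition lattice_matrix :: "real^'n^'n \<Rightarrow> (real^'n) set \<Rightarrow> bool" where
  "lattice_matrix A L \<longleftrightarrow> invertible A \<and> L = (*v) A ` int_vecs"

definition is_lattice :: "(real^'n) set \<Rightarrow> bool" where
  "is_lattice L \<longleftrightarrow> (\<exists>A. lattice_matrix A L)"

definition separable_lattice :: "(real^('d::finite + 'd)) set \<Rightarrow> bool" where
  "separable_lattice L \<longleftrightarrow>
     (\<exists>A1 A2. invertible A1 \<and> invertible A2 \<and> L = (*v) (block_mat A1 0 0 A2) ` int_vecs)"

definition symplectically_related ::
    "(real^('d::finite + 'd)) set \<Rightarrow> (real^('d + 'd)) set \<Rightarrow> bool" where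
  "symplectically_related L L' \<longleftrightarrow> (\<exists>S \<in> Sp. L' = (*v) S ` L)"

definition int_scale :: "int \<Rightarrow> 'a::real_vector \<Rightarrow> 'a" where
  "int_scale k v = of_int k *\<^sub>R v"

global_interpretation int_module: module int_scale
  by unfold_locales (simp_all add: int_scale_def algebra_simps)

text \<open>Span and independence are those of the \<open>\<int>\<close>-module, not of the real vector space.\<close>

definition int_basis :: "('i \<Rightarrow> real^'n) \<Rightarrow> (real^'n) set \<Rightarrow> bool" where
  "int_basis b L \<longleftrightarrow>
     inj b \<and> int_module.independent (range b) \<and> int_module.span (range b) = L"


subsection \<open>The matrices representing the symplectic form in lattice coordinates\<close>

definition GL_int :: "(real^'n^'n) set" where
  "GL_int = {M. (\<forall>i j. M $ i $ j \<in> \<int>) \<and>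
     (\<exists>N. (\<forall>i j. N $ i $ j \<in> \<int>) \<and> M ** N = mat 1 \<and> N ** M = mat 1)}"

text \<open>
  The set does not depend on which lattice matrix \<^term>\<open>A\<close> is used
  (lemma \<open>Theta_lattice_matrix\<close> below), so letting \<^term>\<open>A\<close> range over all of them
  adds nothing.
\<close>

definition Theta :: "(real^('d::finite + 'd)) set \<Rightarrow> (real^('d + 'd)^('d + 'd)) set" where
  "Theta L = {transpose (A ** M) ** J_mat ** (A ** M) | A M. lattice_matrix A L \<and> M \<in> GL_int}"


subsection \<open>Lagrangian planes\<close>

definition sympl_form :: "real^'n^'n \<Rightarrow> real^'n \<Rightarrow> real^'n \<Rightarrow> real" where
  "sympl_form \<theta> z w = w \<bullet> (\<theta> *v z)"

definition lagrangian_plane ::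
    "real^('d::finite + 'd)^('d + 'd) \<Rightarrow> (real^('d + 'd)) set \<Rightarrow> bool" where
  "lagrangian_plane \<theta> l \<longleftrightarrow>
     subspace l \<and> dim l = CARD('d) \<and> (\<forall>z\<in>l. \<forall>w\<in>l. sympl_form \<theta> z w = 0)"

definition transversal_lagrangian_pair ::
    "real^('d::finite + 'd)^('d + 'd) \<Rightarrow> (real^('d + 'd)) set \<Rightarrow> (real^('d + 'd)) set \<Rightarrow> bool" where
  "transversal_lagrangian_pair \<theta> l l' \<longleftrightarrow>
     lagrangian_plane \<theta> l \<and> lagrangian_plane \<theta> l' \<and> {x + y | x y. x \<in> l \<and> y \<in> l'} = UNIV"


subsection \<open>Consistency of the definitions\<close>

lemma int_vecs_mult:
  fixes M :: "real^'n^'n"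
  assumes "\<forall>i j. M $ i $ j \<in> \<int>" "x \<in> int_vecs"
  shows "M *v x \<in> int_vecs"
  using assms by (auto simp: int_vecs_def matrix_vector_mult_def intro!: Ints_sum Ints_mult)

lemma GL_int_image:
  fixes M :: "real^'n^'n"
  assumes "M \<in> GL_int"
  shows "(*v) M ` int_vecs = int_vecs"
proof -
  obtain N where M: "\<forall>i j. M $ i $ j \<in> \<int>" and N: "\<forall>i j. N $ i $ j \<in> \<int>" and MN: "M ** N = mat 1"
    using assms by (auto simp: GL_int_def)
  have "x \<in> (*v) M ` int_vecs" if "x \<in> int_vecs" for x
    by (rule image_eqI[of _ _ "N *v x"])
       (use MN int_vecs_mult[OF N that] in \<open>simp_all add: matrix_vector_mul_assoc\<close>)
  then show ?thesis
    using int_vecs_mult[OF M] by blast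
qed

lemma GL_int_invertible: "M \<in> GL_int \<Longrightarrow> invertible M"
  by (auto simp: GL_int_def invertible_def)

lemma image_matrix_mult:
  "(*v) (A ** B) ` X = (*v) A ` ((*v) B ` (X :: (real^'n) set))"
  by (simp add: image_image matrix_vector_mul_assoc)

lemma lattice_matrix_mult_GL_int:
  fixes A :: "real^'n^'n"
  assumes "lattice_matrix A L" "M \<in> GL_int"
  shows "lattice_matrix (A ** M) L"
  using assms GL_int_image[OF assms(2)] GL_int_invertible[OF assms(2)]
  by (simp add: lattice_matrix_def image_matrix_mult invertible_mult)

lemma matrix_inv_inverse:
  fixes A :: "real^'n^'n"
  assumes "invertible A"
  shows "A ** matrix_inv A = mat 1" "matrix_inv A ** A = mat 1"
  using someI_ex[OF assms[unfolded invertible_def]] by (simp_all add: matrix_inv_def)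

lemma lattice_matrix_factor_int:
  fixes A B :: "real^'n^'n"
  assumes "lattice_matrix A L" "lattice_matrix B L"
  shows "(matrix_inv A ** B) $ i $ j \<in> \<int>"
proof -
  have A: "matrix_inv A ** A = mat 1"
    using assms by (simp add: lattice_matrix_def matrix_inv_inverse)
  have "axis j 1 \<in> int_vecs"
    by (simp add: int_vecs_def axis_def)
  then have "B *v axis j 1 \<in> (*v) A ` int_vecs"
    using assms by (auto simp: lattice_matrix_def)
  then obtain y where y: "y \<in> int_vecs" "B *v axis j 1 = A *v y"
    by blast
  have "(matrix_inv A ** B) *v axis j 1 = y"
    by (metis y(2) A matrix_vector_mul_assoc matrix_vector_mul_lid)
  then have "(matrix_inv A ** B) $ i $ j = y $ i"
    by (metis column_def matrix_vector_mult_basis vec_lambda_beta)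
  then show ?thesis
    using y by (simp add: int_vecs_def)
qed

lemma lattice_matrix_factor:
  fixes A B :: "real^'n^'n"
  assumes A: "lattice_matrix A L" and B: "lattice_matrix B L"
  obtains M where "M \<in> GL_int" "B = A ** M"
proof
  have inv: "A ** matrix_inv A = mat 1" "matrix_inv A ** A = mat 1"
            "B ** matrix_inv B = mat 1" "matrix_inv B ** B = mat 1"
    using A B by (simp_all add: lattice_matrix_def matrix_inv_inverse)
  let ?M = "matrix_inv A ** B" and ?N = "matrix_inv B ** A"
  have MN: "?M ** ?N = mat 1" "?N ** ?M = mat 1"
    by (metis inv matrix_mul_assoc matrix_mul_lid)+
  show "?M \<in> GL_int"
    unfolding GL_int_def
    using MN lattice_matrix_factor_int[OF A B] lattice_matrix_factor_int[OF B A] by blast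
  show "B = A ** ?M"
    by (simp add: matrix_mul_assoc inv)
qed

lemma Theta_lattice_matrix:
  assumes A: "lattice_matrix A L"
  shows "Theta L = {transpose (A ** M) ** J_mat ** (A ** M) | M. M \<in> GL_int}"
proof -
  have "\<exists>M'. M' \<in> GL_int \<and> B ** M = A ** M'" if "lattice_matrix B L" "M \<in> GL_int" for B M
    using lattice_matrix_factor[OF A lattice_matrix_mult_GL_int[OF that]] by metis
  then show ?thesis
    unfolding Theta_def using A by (auto, metis)
qed

lemma Theta_eq: "Theta L = {transpose B ** J_mat ** B | B. lattice_matrix B L}"
proof -
  have "mat 1 \<in> (GL_int :: (real^('a + 'a)^('a + 'a)) set)"
    unfolding GL_int_def by (auto simp: mat_def matrix_mul_lid[unfolded mat_def] intro!: exI[of _ "mat 1"])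
  then show ?thesis
    unfolding Theta_def
    by (auto intro: lattice_matrix_mult_GL_int) (metis matrix_mul_rid)
qed

lemma transpose_J_mat: "transpose J_mat = - J_mat"
  by (auto simp: vec_eq_iff transpose_def J_mat_def block_mat_def mat_def split: sum.splits)

lemma J_mat_square: "J_mat ** J_mat = - mat 1"
proof -
  have *: "(\<Sum>k\<in>UNIV. f k) = (\<Sum>k\<in>UNIV. f (Inl k)) + (\<Sum>k\<in>UNIV. f (Inr k))"
    for f :: "'a + 'a \<Rightarrow> real"
    using sum.Plus[of "UNIV :: 'a set" "UNIV :: 'a set" f] by (simp add: UNIV_Plus_UNIV)
  have J: "J_mat $ Inl i $ Inl j = 0" "J_mat $ Inl i $ Inr j = (if i = j then 1 else 0)"
      "J_mat $ Inr i $ Inl j = (if i = j then - 1 else 0)" "J_mat $ Inr i $ Inr j = 0" for i j :: 'a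
    by (simp_all add: J_mat_def block_mat_def mat_def)
  have "(J_mat ** J_mat) $ i $ j = (- mat 1) $ i $ j" for i j :: "'a + 'a"
    by (cases i; cases j)
       (simp_all add: matrix_matrix_mult_def * J mat_def if_distrib[of "\<lambda>x. x * _"] cong: if_cong)
  then show ?thesis
    by (simp add: vec_eq_iff)
qed

lemma invertible_J_mat: "invertible J_mat"
proof -
  have "J_mat ** (- J_mat) = - (J_mat ** J_mat)" "(- J_mat) ** J_mat = - (J_mat ** J_mat)"
    by (simp_all add: vec_eq_iff matrix_matrix_mult_def sum_negf)
  then have "J_mat ** (- J_mat) = mat 1" "(- J_mat) ** J_mat = mat 1"
    by (simp_all add: J_mat_square)
  then show ?thesis
    unfolding invertible_def by blast
qed

lemma Theta_antisymmetric_invertible: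
  assumes "\<theta> \<in> Theta L"
  shows "transpose \<theta> = - \<theta>" "invertible \<theta>"
proof -
  obtain B where B: "lattice_matrix B L" and \<theta>: "\<theta> = transpose B ** J_mat ** B"
    using assms by (auto simp: Theta_eq)
  have "transpose B ** (- J_mat) ** B = - (transpose B ** J_mat ** B)"
    by (simp add: vec_eq_iff matrix_matrix_mult_def sum_negf)
  then show "transpose \<theta> = - \<theta>"
    by (simp add: \<theta> matrix_transpose_mul matrix_mul_assoc transpose_J_mat)
  show "invertible \<theta>"
    using B unfolding \<theta> lattice_matrix_def
    by (blast intro: invertible_mult invertible_J_mat transpose_invertible)
qed

end

theory Submission
  imports Defs
begin

text \<open>
  A separable lattice has the columns of its block diagonal matrix as a basis lying in two
  transversal coordinate planes, which are Lagrangian; a symplectic map or a change to lattice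
  coordinates transports basis and planes. Conversely, linear independence forces each of the two
  planes to contain exactly \<open>d\<close> of the basis vectors. If \<open>B\<close> is the lattice matrix with the first
  \<open>d\<close> columns in \<open>\<ell>\<close> and the others in \<open>\<ell>'\<close>, then the diagonal blocks of \<open>B\<^sup>T J B\<close> vanish, so
  \<open>B\<^sup>T J B = D\<^sup>T J D\<close> where \<open>D\<close> has diagonal blocks \<open>I\<close> and the upper right block of \<open>B\<^sup>T J B\<close>.
  Hence \<open>D B\<^sup>-\<^sup>1\<close> is symplectic and maps the lattice to \<open>D \<int>\<^sup>2\<^sup>d\<close>.
\<close>

section \<open>Lattice bases as columns of lattice matrices\<close>

definition from_columns :: "('n \<Rightarrow> real^'m) \<Rightarrow> real^'n^'m" where
  "from_columns b = (\<chi> i j. b j $ i)"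

lemma column_from_columns [simp]: "column j (from_columns b) = b j"
  by (simp add: from_columns_def column_def)

lemma from_columns_mult_vec: "from_columns b *v x = (\<Sum>j\<in>UNIV. x $ j *\<^sub>R b j)"
  by (simp add: matrix_mult_sum scalar_mult_eq_scaleR)

lemma matrix_mult_from_columns: "A ** from_columns b = from_columns (\<lambda>j. A *v b j)"
  by (simp add: from_columns_def matrix_matrix_mult_def matrix_vector_mult_def vec_eq_iff)

lemma from_columns_column [simp]: "from_columns (\<lambda>j. column j A) = A"
  by (simp add: from_columns_def column_def vec_eq_iff)

text \<open>Injectivity of \<open>b\<close> identifies coefficient functions on the set
  \<open>range b\<close> with coefficient vectors indexed by \<open>'n\<close>, so integer
  combinations become products with integer vectors.\<close>

lemma int_span_range:
  fixes b :: "'n::finite \<Rightarrow> real^'m"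
  assumes "inj b"
  shows "int_module.span (range b) = (*v) (from_columns b) ` int_vecs"
proof -
  have "(\<Sum>v\<in>range b. int_scale (u v) v) = from_columns b *v (\<chi> j. of_int (u (b j)))" for u
    using assms by (simp add: sum.reindex from_columns_mult_vec int_scale_def)
  moreover have "\<exists>u. x = (\<chi> j. of_int (u (b j)))" if "x \<in> int_vecs" for x :: "real^'n"
  proof
    \<comment> \<open>The witness for \<open>u\<close> looks up the index of a basis vector with
      \<open>inv b\<close>; the floor only turns an integral real into an
      \<open>int\<close>.\<close>
    show "x = (\<chi> j. of_int (\<lfloor>x $ inv b (b j)\<rfloor>))"
      using that assms by (simp add: vec_eq_iff int_vecs_def)
  qed
  moreover have "(\<chi> j. of_int (u (b j))) \<in> int_vecs" for u
    by (simp add: int_vecs_def)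
  ultimately show ?thesis
    by (fastforce simp: int_module.span_finite)
qed

text \<open>A linear relation among the columns is a kernel vector, hence zero. Injectivity is
  stated separately because the set \<open>range b\<close> cannot show a repeated column.\<close>

lemma invertible_from_columns:
  fixes b :: "'n \<Rightarrow> real^'n"
  assumes "invertible (from_columns b)"
  shows "inj b" "independent (range b)"
proof -
  have *: "\<forall>j. x $ j = 0" if "(\<Sum>j\<in>UNIV. x $ j *\<^sub>R b j) = 0" for x
    using assms that
    by (metis from_columns_mult_vec invertible_left_inverse matrix_left_invertible_ker zero_index)
  show inj: "inj b"
  proof (rule injI, rule ccontr)
    fix i j assume "b i = b j" "i \<noteq> j"
    then have "from_columns b *v axis i 1 = from_columns b *v axis j 1"
      by (simp add: matrix_vector_mul_component matrix_vector_mult_basis)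
    then have "axis i 1 = (axis j 1 :: real^'n)"
      using inj_matrix_vector_mult[OF assms] by (simp add: inj_eq)
    with \<open>i \<noteq> j\<close> show False
      by (simp add: axis_eq_axis)
  qed
  show "independent (range b)"
  proof (rule independent_if_scalars_zero)
    fix u v assume "(\<Sum>x\<in>range b. u x *\<^sub>R x) = 0" "v \<in> range b"
    then show "u v = 0"
      using *[of "\<chi> j. u (b j)"] inj by (auto simp: sum.reindex)
  qed simp
qed

text \<open>Independence over the integers does not by itself give independence over the reals, so
  invertibility comes from comparison with a known lattice matrix \<open>A\<close>: its columns lie
  in the span of \<open>b\<close>, so \<open>A\<close> factors through
  \<open>from_columns b\<close>, whose determinant is therefore nonzero. Conversely, an integer
  relation is also a real one.\<close>

lemma int_basis_iff_lattice_matrix: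
  fixes b :: "'n \<Rightarrow> real^'n"
  assumes "is_lattice L"
  shows "int_basis b L \<longleftrightarrow> lattice_matrix (from_columns b) L"
proof
  assume b: "int_basis b L"
  then have L: "L = (*v) (from_columns b) ` int_vecs"
    using int_span_range[of b] by (simp add: int_basis_def)
  obtain A :: "real^'n^'n" where A: "invertible A" "L = (*v) A ` int_vecs"
    using assms by (auto simp: is_lattice_def lattice_matrix_def)
  have "\<exists>x. A *v axis j 1 = from_columns b *v x" for j
  proof -
    have "A *v axis j 1 \<in> L"
      unfolding A by (rule imageI) (simp add: int_vecs_def axis_def)
    then show ?thesis
      using L by auto
  qed
  then obtain m where m: "A *v axis j 1 = from_columns b *v m j" for j
    by metis
  have "A = from_columns b ** from_columns m"
    unfolding matrix_mult_from_columns m[symmetric] matrix_vector_mult_basis by simp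
  then have "invertible (from_columns b)"
    using A(1) by (metis det_mul invertible_det_nz mult_eq_0_iff)
  with L show "lattice_matrix (from_columns b) L"
    by (simp add: lattice_matrix_def)
next
  assume b: "lattice_matrix (from_columns b) L"
  then have "invertible (from_columns b)"
    by (simp add: lattice_matrix_def)
  note inv = invertible_from_columns[OF this]
  have "int_module.independent (range b)"
  proof
    assume "int_module.dependent (range b)"
    then obtain u v where uv: "v \<in> range b" "u v \<noteq> 0" "(\<Sum>x\<in>range b. int_scale (u x) x) = 0"
      by (auto simp: int_module.dependent_finite)
    then have "dependent (range b)"
      unfolding dependent_finite[OF finite_imageI[OF finite]] int_scale_def
      by (intro exI[of _ "\<lambda>x. of_int (u x)"] conjI bexI[of _ v]) auto
    with inv(2) show False
      by simp
  qed
  then show "int_basis b L"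
    using inv b int_span_range[of b] by (simp add: int_basis_def lattice_matrix_def)
qed

section \<open>Images of lattices and Lagrangian planes under invertible matrices\<close>

lemma lattice_matrix_image:
  fixes A B :: "real^'n^'n"
  assumes "invertible A" "lattice_matrix B L"
  shows "lattice_matrix (A ** B) ((*v) A ` L)"
  using assms by (simp add: lattice_matrix_def invertible_mult image_matrix_mult)

lemma is_lattice_image:
  fixes A :: "real^'n^'n"
  assumes "is_lattice L" "invertible A"
  shows "is_lattice ((*v) A ` L)"
  using assms unfolding is_lattice_def by (blast intro: lattice_matrix_image)

lemma int_basis_image:
  fixes A :: "real^'n^'n" and b :: "'n \<Rightarrow> real^'n"
  assumes "is_lattice L" "invertible A" "int_basis b L"
  shows "int_basis (\<lambda>j. A *v b j) ((*v) A ` L)"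
  using assms lattice_matrix_image[of A "from_columns b" L]
  by (simp add: int_basis_iff_lattice_matrix is_lattice_image matrix_mult_from_columns)

lemma sympl_form_congruence:
  fixes B :: "real^'n^'n"
  shows "sympl_form (transpose B ** \<theta> ** B) z w = sympl_form \<theta> (B *v z) (B *v w)"
  by (simp add: sympl_form_def inner_commute[of w] inner_commute[of "B *v w"] dot_lmul_matrix
      flip: matrix_vector_mul_assoc)

lemma sympl_form_axis: "sympl_form \<theta> (axis j 1) (axis i 1) = \<theta> $ i $ j"
  by (simp add: sympl_form_def inner_axis' matrix_vector_mult_basis column_def)

text \<open>\<open>B\<close> carries the form of \<open>transpose B ** \<theta> ** B\<close> to that
  of \<open>\<theta>\<close>, and its injectivity preserves dimensions.\<close>

lemma lagrangian_plane_image: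
  fixes B :: "real^('d::finite + 'd)^('d + 'd)"
  assumes "invertible B" "lagrangian_plane (transpose B ** \<theta> ** B) l"
  shows "lagrangian_plane \<theta> ((*v) B ` l)"
proof -
  have "dim ((*v) B ` l) = dim l"
    using inj_matrix_vector_mult[OF assms(1)] by (intro dim_image_eq) (auto intro: inj_on_subset)
  then show ?thesis
    using assms(2)
    by (auto simp: lagrangian_plane_def sympl_form_congruence
        intro: linear_subspace_image matrix_vector_mul_linear)
qed

lemma transversal_lagrangian_pair_image:
  fixes B :: "real^('d::finite + 'd)^('d + 'd)"
  assumes B: "invertible B" and l: "transversal_lagrangian_pair (transpose B ** \<theta> ** B) l l'"
  shows "transversal_lagrangian_pair \<theta> ((*v) B ` l) ((*v) B ` l')"
proof -
  have "v \<in> {x + y | x y. x \<in> (*v) B ` l \<and> y \<in> (*v) B ` l'}" for v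
  proof -
    \<comment> \<open>Split the preimage of \<open>v\<close> and map the two summands
      forward.\<close>
    have "matrix_inv B *v v \<in> {x + y | x y. x \<in> l \<and> y \<in> l'}"
      using l by (simp add: transversal_lagrangian_pair_def)
    then obtain x y where xy: "x \<in> l" "y \<in> l'" "matrix_inv B *v v = x + y"
      by blast
    have "v = B *v (matrix_inv B *v v)"
      using B by (simp add: matrix_vector_mul_assoc matrix_inv_inverse)
    also have "\<dots> = B *v x + B *v y"
      by (simp add: xy matrix_vector_right_distrib)
    finally show ?thesis
      using xy by blast
  qed
  then show ?thesis
    using assms by (auto simp: transversal_lagrangian_pair_def intro: lagrangian_plane_image)
qed

section \<open>Block matrix algebra\<close>

lemma sum_UNIV_Plus:
  fixes f :: "'a::finite + 'b::finite \<Rightarrow> 'c::comm_monoid_add"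
  shows "sum f UNIV = (\<Sum>k\<in>UNIV. f (Inl k)) + (\<Sum>k\<in>UNIV. f (Inr k))"
  using sum.Plus[of "UNIV :: 'a set" "UNIV :: 'b set" f] by simp

lemma block_mat_mult:
  "block_mat P Q R S ** block_mat P' Q' R' S' =
   block_mat (P ** P' + Q ** R') (P ** Q' + Q ** S') (R ** P' + S ** R') (R ** Q' + S ** S')"
  by (auto simp: vec_eq_iff matrix_matrix_mult_def block_mat_def sum_UNIV_Plus split: sum.split)

lemma transpose_block_mat:
  "transpose (block_mat P Q R S) = block_mat (transpose P) (transpose R) (transpose Q) (transpose S)"
  by (auto simp: vec_eq_iff transpose_def block_mat_def split: sum.split)

lemma block_mat_eq_iff:
  "block_mat P Q R S = block_mat P' Q' R' S' \<longleftrightarrow> P = P' \<and> Q = Q' \<and> R = R' \<and> S = S'"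
  by (simp add: vec_eq_iff block_mat_def split_sum_all all_conj_distrib)

lemma matrix_mult_minus: "A ** (- B) = - (A ** B :: real^_^_)"
  by (simp add: matrix_matrix_mult_def vec_eq_iff sum_negf)

lemma transpose_zero: "transpose 0 = 0"
  by (simp add: transpose_def vec_eq_iff)

lemma mat_1_block: "mat 1 = block_mat (mat 1) 0 0 (mat 1)"
  by (auto simp: vec_eq_iff mat_def block_mat_def split: sum.split)

text \<open>The diagonal blocks of a left inverse are left inverses of \<open>P\<close> and
  \<open>S\<close>, and for square matrices a left inverse suffices.\<close>

lemma invertible_block_diag_iff:
  "invertible (block_mat P 0 0 S) \<longleftrightarrow> invertible P \<and> invertible S"
proof
  assume "invertible (block_mat P 0 0 S)"
  then obtain N where N: "N ** block_mat P 0 0 S = mat 1"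
    by (auto simp: invertible_def)
  define N1 N2 N3 N4 where "N1 = (\<chi> i j. N $ Inl i $ Inl j)" and "N2 = (\<chi> i j. N $ Inl i $ Inr j)"
    and "N3 = (\<chi> i j. N $ Inr i $ Inl j)" and "N4 = (\<chi> i j. N $ Inr i $ Inr j)"
  have "N = block_mat N1 N2 N3 N4"
    by (auto simp: vec_eq_iff block_mat_def N1_def N2_def N3_def N4_def split: sum.split)
  then have "block_mat (N1 ** P) (N2 ** S) (N3 ** P) (N4 ** S) = block_mat (mat 1) 0 0 (mat 1)"
    using N by (simp add: block_mat_mult mat_1_block)
  then have "N1 ** P = mat 1" "N4 ** S = mat 1"
    by (simp_all add: block_mat_eq_iff)
  then show "invertible P \<and> invertible S"
    using invertible_left_inverse by blast
next
  assume "invertible P \<and> invertible S"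
  then obtain P' S' where "P' ** P = mat 1" "S' ** S = mat 1"
    by (auto simp: invertible_def)
  then have "block_mat P' 0 0 S' ** block_mat P 0 0 S = mat 1"
    by (simp add: block_mat_mult mat_1_block)
  then show "invertible (block_mat P 0 0 S)"
    using invertible_left_inverse by blast
qed

text \<open>Every antisymmetric matrix with vanishing diagonal blocks has the shape on the right, so
  it is congruent to \<open>J_mat\<close> through a block diagonal matrix whose first block is
  normalized to the identity.\<close>

lemma J_mat_congruence_block_diag:
  "transpose (block_mat (mat 1) 0 0 K) ** J_mat ** block_mat (mat 1) 0 0 K =
   block_mat 0 K (- transpose K) 0"
  by (simp add: transpose_block_mat J_mat_def block_mat_mult transpose_zero matrix_mult_minus)

section \<open>Lagrangian bases under change of coordinates\<close>

lemma congruence_inverse: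
  fixes B N :: "real^'n^'n"
  assumes "B ** N = mat 1"
  shows "transpose N ** (transpose B ** \<theta> ** B) ** N = \<theta>"
proof -
  have "transpose N ** (transpose B ** \<theta> ** B) ** N = transpose (B ** N) ** \<theta> ** (B ** N)"
    by (simp add: matrix_transpose_mul matrix_mul_assoc)
  then show ?thesis
    by (simp add: assms)
qed

text \<open>The common form of conditions (c) and (d): (c) is the case of \<open>J_mat\<close> and
  the lattice itself, (d) the case of \<open>\<theta>\<close> in \<open>Theta\<close> and
  \<open>int_vecs\<close>.\<close>

definition has_lagrangian_basis ::
    "real^('d::finite + 'd)^('d + 'd) \<Rightarrow> (real^('d + 'd)) set \<Rightarrow> bool" where
  "has_lagrangian_basis \<theta> L \<longleftrightarrow> (\<exists>(b :: 'd + 'd \<Rightarrow> real^('d + 'd)) l l'.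
     int_basis b L \<and> transversal_lagrangian_pair \<theta> l l' \<and> range b \<subseteq> l \<union> l')"

lemma has_lagrangian_basis_image:
  fixes B :: "real^('d::finite + 'd)^('d + 'd)"
  assumes L: "is_lattice L" and B: "invertible B"
    and *: "has_lagrangian_basis (transpose B ** \<theta> ** B) L"
  shows "has_lagrangian_basis \<theta> ((*v) B ` L)"
proof -
  obtain b :: "'d + 'd \<Rightarrow> real^('d + 'd)" and l l' where b: "int_basis b L"
    and l: "transversal_lagrangian_pair (transpose B ** \<theta> ** B) l l'" and r: "range b \<subseteq> l \<union> l'"
    using * by (auto simp: has_lagrangian_basis_def)
  have "range (\<lambda>j. B *v b j) \<subseteq> (*v) B ` l \<union> (*v) B ` l'"
    using r by blast
  then show ?thesis
    using int_basis_image[OF L B b] transversal_lagrangian_pair_image[OF B l]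
    unfolding has_lagrangian_basis_def by blast
qed

text \<open>The forward direction is the transport lemma applied to the inverse of \<open>B\<close>,
  whose congruence undoes that of \<open>B\<close>.\<close>

lemma has_lagrangian_basis_image_iff:
  fixes B :: "real^('d::finite + 'd)^('d + 'd)"
  assumes L: "is_lattice L" and B: "invertible B"
  shows "has_lagrangian_basis \<theta> ((*v) B ` L) \<longleftrightarrow> has_lagrangian_basis (transpose B ** \<theta> ** B) L"
proof
  assume *: "has_lagrangian_basis \<theta> ((*v) B ` L)"
  let ?N = "matrix_inv B"
  have N: "B ** ?N = mat 1" "?N ** B = mat 1"
    using matrix_inv_inverse[OF B] by auto
  then have "invertible ?N"
    by (auto simp: invertible_def)
  moreover have "is_lattice ((*v) B ` L)"
    using L B by (rule is_lattice_image)
  moreover have "has_lagrangian_basis (transpose ?N ** (transpose B ** \<theta> ** B) ** ?N) ((*v) B ` L)"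
    using * by (simp only: congruence_inverse[OF N(1)])
  ultimately have "has_lagrangian_basis (transpose B ** \<theta> ** B) ((*v) ?N ` ((*v) B ` L))"
    using has_lagrangian_basis_image[of "(*v) B ` L" ?N] by blast
  then show "has_lagrangian_basis (transpose B ** \<theta> ** B) L"
    by (simp add: N flip: image_matrix_mult)
qed (rule has_lagrangian_basis_image[OF assms])

lemma is_lattice_int_vecs: "is_lattice int_vecs"
  unfolding is_lattice_def lattice_matrix_def
  by (rule exI[of _ "mat 1"]) (simp add: invertible_def exI[of _ "mat 1"])

text \<open>A lattice matrix \<open>B\<close> representing \<open>\<theta>\<close> maps
  \<open>int_vecs\<close> onto \<open>L\<close> and \<open>\<theta>\<close>-Lagrangian planes to
  \<open>J_mat\<close>-Lagrangian ones. The right side is free of \<open>\<theta>\<close>, which is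
  why "some" and "every" agree in (d).\<close>

lemma has_lagrangian_basis_Theta:
  fixes L :: "(real^('d::finite + 'd)) set"
  assumes "\<theta> \<in> Theta L"
  shows "has_lagrangian_basis \<theta> int_vecs \<longleftrightarrow> has_lagrangian_basis J_mat L"
proof -
  obtain B where "lattice_matrix B L" "\<theta> = transpose B ** J_mat ** B"
    using assms by (auto simp: Theta_eq)
  then show ?thesis
    using has_lagrangian_basis_image_iff[OF is_lattice_int_vecs, of B J_mat]
    by (simp add: lattice_matrix_def)
qed

text \<open>Take determinants in the defining equation; that of \<open>J_mat\<close> is
  nonzero.\<close>

lemma Sp_invertible:
  assumes "S \<in> Sp"
  shows "invertible S"
proof -
  have "det (transpose S ** J_mat ** S) = det (J_mat :: real^('a + 'a)^('a + 'a))"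
    using assms by (simp add: Sp_def)
  then show ?thesis
    using invertible_J_mat[where ?'a = 'a] by (auto simp: invertible_det_nz det_mul)
qed

section \<open>Separable lattices and the two coordinate Lagrangian planes\<close>

definition coordinate_plane :: "'n set \<Rightarrow> (real^'n) set" where
  "coordinate_plane I = {x. \<forall>i. i \<notin> I \<longrightarrow> x $ i = 0}"

text \<open>Each product pairs an \<open>Inl\<close> with an \<open>Inr\<close> coordinate, so the
  form vanishes on either coordinate plane.\<close>

lemma sympl_form_J_mat:
  "sympl_form J_mat z w = (\<Sum>k\<in>UNIV. w $ Inl k * z $ Inr k) - (\<Sum>k\<in>UNIV. w $ Inr k * z $ Inl k)"
  by (simp add: sympl_form_def inner_vec_def matrix_vector_mult_def sum_UNIV_Plus J_mat_def
      block_mat_def mat_def if_distrib[of "\<lambda>x. x * _"] sum_negf cong: if_cong)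

lemma transversal_coordinate_planes:
  "transversal_lagrangian_pair (J_mat :: real^('d::finite + 'd)^('d + 'd))
     (coordinate_plane (range Inl)) (coordinate_plane (range Inr))"
proof -
  have "subspace (coordinate_plane I)" for I :: "('d + 'd) set"
    by (auto simp: coordinate_plane_def subspace_def)
  moreover have "dim (coordinate_plane I) = card I" for I :: "('d + 'd) set"
    by (simp only: coordinate_plane_def dim_vec_eq[symmetric] dim_substandard_cart)
  moreover have "\<exists>x y. v = x + y \<and> x \<in> coordinate_plane (range Inl) \<and> y \<in> coordinate_plane (range Inr)"
    for v :: "real^('d + 'd)"
    by (intro exI[of _ "\<chi> i. if i \<in> range Inl then v $ i else 0"]
        exI[of _ "\<chi> i. if i \<in> range Inl then 0 else v $ i"])
       (auto simp: coordinate_plane_def vec_eq_iff split_sum_all)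
  moreover have "sympl_form J_mat z w = 0"
    if "z \<in> coordinate_plane (range Inl) \<and> w \<in> coordinate_plane (range Inl) \<or>
        z \<in> coordinate_plane (range Inr) \<and> w \<in> coordinate_plane (range Inr)"
    for z w :: "real^('d + 'd)"
  proof -
    have "Inr k \<notin> range Inl" "Inl k \<notin> range Inr" for k :: 'd
      by auto
    with that have "(\<forall>k. z $ Inr k = 0) \<and> (\<forall>k. w $ Inr k = 0) \<or> (\<forall>k. z $ Inl k = 0) \<and> (\<forall>k. w $ Inl k = 0)"
      unfolding coordinate_plane_def by blast
    then show ?thesis
      by (auto simp: sympl_form_J_mat)
  qed
  moreover have "card (range (Inl :: 'd \<Rightarrow> 'd + 'd)) = CARD('d)" "card (range (Inr :: 'd \<Rightarrow> 'd + 'd)) = CARD('d)"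
    by (simp_all add: card_image)
  ultimately show ?thesis
    unfolding transversal_lagrangian_pair_def lagrangian_plane_def by (simp add: set_eq_iff)
qed

lemma separable_has_lagrangian_basis:
  assumes "separable_lattice L"
  shows "has_lagrangian_basis J_mat L"
proof -
  obtain A1 A2 where inv: "invertible A1" "invertible A2"
    and L: "L = (*v) (block_mat A1 0 0 A2) ` int_vecs"
    using assms by (auto simp: separable_lattice_def)
  define D where "D = block_mat A1 0 0 A2"
  have D: "lattice_matrix D L"
    using inv L by (simp add: D_def lattice_matrix_def invertible_block_diag_iff)
  then have "int_basis (\<lambda>j. column j D) L"
    by (subst int_basis_iff_lattice_matrix) (auto simp: is_lattice_def)
  \<comment> \<open>The zero blocks confine each column to the half of the coordinates that contains
    its own index.\<close>
  moreover have "column j D \<in> coordinate_plane (range Inl) \<union> coordinate_plane (range Inr)" for j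
    by (cases j) (auto simp: coordinate_plane_def column_def D_def block_mat_def split: sum.split)
  ultimately show ?thesis
    unfolding has_lagrangian_basis_def using transversal_coordinate_planes by blast
qed

section \<open>From a Lagrangian basis to a separable lattice\<close>

lemma card_basis_vectors_in_plane:
  fixes b :: "'n::finite \<Rightarrow> 'a::euclidean_space"
  assumes "inj b" "independent (range b)"
  shows "card {i. b i \<in> l} \<le> dim l"
proof -
  have "independent (b ` {i. b i \<in> l})"
    using assms(2) by (rule independent_mono) auto
  then have "card (b ` {i. b i \<in> l}) \<le> dim l"
    by (intro independent_card_le_dim) auto
  then show ?thesis
    using assms(1) by (simp add: card_image inj_on_subset)
qed

text \<open>The indices outside \<open>p\<close> satisfy \<open>q\<close>, so both \<open>p\<close>
  and its complement have at most \<open>d\<close> elements; as there are \<open>2d\<close> in all,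
  both have exactly \<open>d\<close>. Enumerations of the two sets glue to
  \<open>\<sigma>\<close>.\<close>

lemma split_index_sum:
  fixes p q :: "'d::finite + 'd \<Rightarrow> bool"
  assumes "card {i. p i} \<le> CARD('d)" "card {i. q i} \<le> CARD('d)" "\<And>i. p i \<or> q i"
  obtains \<sigma> :: "'d + 'd \<Rightarrow> 'd + 'd" where "bij \<sigma>" "\<And>k. p (\<sigma> (Inl k))" "\<And>k. q (\<sigma> (Inr k))"
proof -
  let ?P = "{i. p i}"
  have "card ?P + card (- ?P) = CARD('d) + CARD('d)"
    using card_Un_disjoint[of ?P "- ?P"] by (simp add: Compl_partition)
  moreover have "card (- ?P) \<le> card {i. q i}"
    using assms(3) by (intro card_mono) auto
  ultimately have "card ?P = CARD('d)" "card (- ?P) = CARD('d)"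
    using assms by auto
  then obtain f g where f: "bij_betw f (UNIV :: 'd set) ?P" and g: "bij_betw g (UNIV :: 'd set) (- ?P)"
    using finite_same_card_bij[OF finite finite, of "UNIV :: 'd set"] by metis
  show ?thesis
  proof
    have "range (case_sum f g) = range f \<union> range g"
      by (auto simp: UNIV_sum image_Un image_image simp del: Un_UNIV_right)
    moreover have "inj (case_sum f g)"
      using f g by (intro inj_onI) (auto simp: bij_betw_def inj_eq split: sum.splits)
    ultimately show "bij (case_sum f g)"
      using f g by (auto simp: bij_betw_def bij_def)
    have "f k \<in> ?P" "g k \<in> - ?P" for k
      using f g by (auto dest: bij_betwE)
    then show "p (case_sum f g (Inl k))" "q (case_sum f g (Inr k))" for k
      using assms(3) by auto
  qed
qed

lemma has_lagrangian_basis_imp_separable: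
  fixes L :: "(real^('d::finite + 'd)) set"
  assumes L: "is_lattice L" and *: "has_lagrangian_basis J_mat L"
  shows "\<exists>L'. separable_lattice L' \<and> symplectically_related L L'"
proof -
  obtain b :: "'d + 'd \<Rightarrow> real^('d + 'd)" and l l' where b: "int_basis b L"
    and l: "lagrangian_plane J_mat l" "lagrangian_plane J_mat l'" and r: "range b \<subseteq> l \<union> l'"
    using * by (auto simp: has_lagrangian_basis_def transversal_lagrangian_pair_def)
  have "invertible (from_columns b)"
    using b by (simp add: int_basis_iff_lattice_matrix[OF L] lattice_matrix_def)
  note ind = invertible_from_columns[OF this]
  have "card {i. b i \<in> l} \<le> CARD('d)" "card {i. b i \<in> l'} \<le> CARD('d)"
    using card_basis_vectors_in_plane[OF ind, of l] card_basis_vectors_in_plane[OF ind, of l'] l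
    by (simp_all add: lagrangian_plane_def)
  then obtain \<sigma> :: "'d + 'd \<Rightarrow> 'd + 'd"
    where \<sigma>: "bij \<sigma>" "b (\<sigma> (Inl k)) \<in> l" "b (\<sigma> (Inr k)) \<in> l'" for k
    using r by (rule_tac split_index_sum[of "\<lambda>i. b i \<in> l" "\<lambda>i. b i \<in> l'"]) auto
  define B where "B = from_columns (b \<circ> \<sigma>)"
  \<comment> \<open>A permutation preserves injectivity and the range, on which alone
    \<open>int_basis\<close> depends.\<close>
  have "int_basis (b \<circ> \<sigma>) L"
    using b \<sigma>(1) by (simp add: int_basis_def bij_def inj_compose flip: image_image image_comp)
  then have B: "lattice_matrix B L"
    by (simp add: B_def int_basis_iff_lattice_matrix[OF L])
  \<comment> \<open>The Gram matrix of the symplectic form in the reordered basis.\<close>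
  define \<theta> where "\<theta> = transpose B ** J_mat ** B"
  define K where "K = (\<chi> i j. \<theta> $ Inl i $ Inr j)"
  have \<theta>: "\<theta> $ i $ j = sympl_form J_mat (b (\<sigma> j)) (b (\<sigma> i))" for i j
    unfolding \<theta>_def sympl_form_axis[symmetric] sympl_form_congruence
    by (simp add: B_def matrix_vector_mult_basis)
  have "\<theta> \<in> Theta L"
    using B by (auto simp: Theta_eq \<theta>_def)
  note \<theta>_inv = Theta_antisymmetric_invertible[OF this]
  \<comment> \<open>These entries pair two basis vectors of the same Lagrangian plane. Antisymmetry
    then determines the lower left block from \<open>K\<close>.\<close>
  have "\<theta> $ Inl i $ Inl j = 0" "\<theta> $ Inr i $ Inr j = 0" for i j
    using \<sigma> l by (auto simp: \<theta> lagrangian_plane_def)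
  moreover have "\<theta> $ Inr i $ Inl j = - (\<theta> $ Inl j $ Inr i)" for i j
    using arg_cong[OF \<theta>_inv(1), of "\<lambda>M. M $ Inl j $ Inr i"] by (simp add: transpose_def)
  ultimately have "\<theta> = block_mat 0 K (- transpose K) 0"
    by (simp add: vec_eq_iff block_mat_def K_def transpose_def split_sum_all)
  also have "\<dots> = transpose (block_mat (mat 1) 0 0 K) ** J_mat ** block_mat (mat 1) 0 0 K"
    by (simp add: J_mat_congruence_block_diag)
  finally have D: "transpose (block_mat (mat 1) 0 0 K) ** J_mat ** block_mat (mat 1) 0 0 K = \<theta>" ..
  define D where "D = block_mat (mat 1) 0 0 K"
  \<comment> \<open>\<open>det \<theta>\<close> is nonzero and has \<open>det D\<close> as a factor;
    invertibility of \<open>K\<close> follows.\<close>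
  have "invertible D"
    using \<theta>_inv(2) unfolding D[symmetric] D_def[symmetric]
    by (auto simp: invertible_det_nz det_mul)
  then have "invertible (mat 1 :: real^'d^'d)" "invertible K"
    by (auto simp: D_def invertible_block_diag_iff)
  then have "separable_lattice ((*v) D ` int_vecs)"
    unfolding separable_lattice_def D_def by blast
  moreover have "symplectically_related L ((*v) D ` int_vecs)"
    unfolding symplectically_related_def
  proof
    have N: "B ** matrix_inv B = mat 1" "matrix_inv B ** B = mat 1"
      using B by (auto simp: lattice_matrix_def matrix_inv_inverse)
    \<comment> \<open>The columns of \<open>D\<close> and of \<open>B\<close> have the same Gram
      matrix \<open>\<theta>\<close>, so the map taking the latter to the former preserves the
      form.\<close>
    have "transpose (D ** matrix_inv B) ** J_mat ** (D ** matrix_inv B) =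
        transpose (matrix_inv B) ** (transpose D ** J_mat ** D) ** matrix_inv B"
      by (simp add: matrix_transpose_mul matrix_mul_assoc)
    also have "\<dots> = transpose (matrix_inv B) ** (transpose B ** J_mat ** B) ** matrix_inv B"
      using D by (simp add: D_def \<theta>_def)
    also have "\<dots> = J_mat"
      using N(1) by (rule congruence_inverse)
    finally show "D ** matrix_inv B \<in> Sp"
      by (simp add: Sp_def)
    show "(*v) D ` int_vecs = (*v) (D ** matrix_inv B) ` L"
      using B N by (simp add: lattice_matrix_def flip: image_matrix_mult matrix_mul_assoc)
  qed
  ultimately show ?thesis
    by blast
qed

section \<open>The equivalences\<close>

lemma separable_iff_has_lagrangian_basis:
  fixes L :: "(real^('d::finite + 'd)) set"
  assumes L: "is_lattice L"
  shows "(\<exists>L'. separable_lattice L' \<and> symplectically_related L L') \<longleftrightarrow> has_lagrangian_basis J_mat L"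
proof
  assume "\<exists>L'. separable_lattice L' \<and> symplectically_related L L'"
  then obtain S where S: "S \<in> Sp" and sep: "separable_lattice ((*v) S ` L)"
    by (auto simp: symplectically_related_def)
  \<comment> \<open>Pull the Lagrangian basis of the separable image back along \<open>S\<close>;
    the pulled-back form is again \<open>J_mat\<close>.\<close>
  have "has_lagrangian_basis (transpose S ** J_mat ** S) L"
    using has_lagrangian_basis_image_iff[OF L Sp_invertible[OF S]]
      separable_has_lagrangian_basis[OF sep] by blast
  then show "has_lagrangian_basis J_mat L"
    using S by (simp add: Sp_def)
qed (rule has_lagrangian_basis_imp_separable[OF L])

theorem proposition6p2:
  fixes \<Lambda> :: "(real^('d::finite + 'd)) set"
  assumes "is_lattice \<Lambda>"
  shows
    "((\<exists>\<Lambda>'. separable_lattice \<Lambda>' \<and> symplectically_related \<Lambda> \<Lambda>') \<longleftrightarrow>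
        (\<exists>(lam :: 'd + 'd \<Rightarrow> real^('d + 'd)) l l'.
           int_basis lam \<Lambda> \<and> transversal_lagrangian_pair J_mat l l' \<and> range lam \<subseteq> l \<union> l'))
     \<and> ((\<exists>\<Lambda>'. separable_lattice \<Lambda>' \<and> symplectically_related \<Lambda> \<Lambda>') \<longleftrightarrow>
        (\<exists>\<theta> \<in> Theta \<Lambda>. \<exists>(b :: 'd + 'd \<Rightarrow> real^('d + 'd)) l l'.
           int_basis b int_vecs \<and> transversal_lagrangian_pair \<theta> l l' \<and> range b \<subseteq> l \<union> l'))
     \<and> ((\<exists>\<Lambda>'. separable_lattice \<Lambda>' \<and> symplectically_related \<Lambda> \<Lambda>') \<longleftrightarrow>
        (\<forall>\<theta> \<in> Theta \<Lambda>. \<exists>(b :: 'd + 'd \<Rightarrow> real^('d + 'd)) l l'.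
           int_basis b int_vecs \<and> transversal_lagrangian_pair \<theta> l l' \<and> range b \<subseteq> l \<union> l'))"
  unfolding separable_iff_has_lagrangian_basis[OF assms] has_lagrangian_basis_def[symmetric]
proof -
  \<comment> \<open>Nonemptiness supplies the witness for "some" and keeps "every" from holding
    vacuously.\<close>
  have "Theta \<Lambda> \<noteq> {}"
    using assms by (auto simp: Theta_eq is_lattice_def)
  then show "(has_lagrangian_basis J_mat \<Lambda> \<longleftrightarrow> has_lagrangian_basis J_mat \<Lambda>)
     \<and> (has_lagrangian_basis J_mat \<Lambda> \<longleftrightarrow> (\<exists>\<theta>\<in>Theta \<Lambda>. has_lagrangian_basis \<theta> int_vecs))
     \<and> (has_lagrangian_basis J_mat \<Lambda> \<longleftrightarrow> (\<forall>\<theta>\<in>Theta \<Lambda>. has_lagrangian_basis \<theta> int_vecs))"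
    by (auto simp: has_lagrangian_basis_Theta)
qed

end
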